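(* For any integers $k \geq 2$, $\beta,n,\rho \geq 0$ and $\alpha > 0$, $$C^k_{n,(\alpha,\beta),\rho} = \begin{cases} C^k_{n,(\alpha-1,\beta-1)} & \text{ if } \rho=0,\\[4pt] \displaystyle{\sum_{i=0}^{n-\rho} C^k_{i,(\alpha-1,k-2)} \, R_{k,\beta+(\rho-1)(k-1)}(n-\rho-i)} & \text{ if } \rho >0. \end{cases}$$
   Context: For an integer $k\ge 2$ and integers $\alpha,\beta, n\ge 0$, let $\mathcal{D}^k_{n,(\alpha,\beta)}$ be the set of integer lattice paths from $(0,\alpha)$ to $(kn+\beta-\alpha,\beta)$ using steps $U=(1,1)$ and $D=(1,1-k)$ that stay weakly above the line $y=0$ (such paths have exactly $n$ steps $D$; the empty path is included when $n=0$, $\alpha=\beta$), and $C^k_{n,(\alpha,\beta)}=|\mathcal{D}^k_{n,(\alpha,\beta)}|$ (set to $0$ if $\alpha<0$ or $\beta<0$). A return to ground is a $D$ step whose right endpoint lies on $y=0$; $C^k_{n,(\alpha,\beta),\rho}$ is the number of paths in $\mathcal{D}^k_{n,(\alpha,\beta)}$ with exactly $\rho$ returns to ground. For $r\ge0$, $R_{k,r}(m)=[t^m]C_k(t)^r$, where $C_k(t)=\sum_{n\ge0} \frac{1}{kn+1}\binom{kn+1}{n} t^n$; for $r\ge1$ this Raney number equals $\frac{r}{km+r}\binom{km+r}{m}$. *)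

theory Defs
  imports "HOL-Computational_Algebra.Formal_Power_Series" "HOL-Library.Product_Plus"
begin

text \<open>A lattice path is represented by its list of steps; its starting point \<open>(0, \<alpha>)\<close> is
  a separate argument.\<close>

datatype step = U | D

fun step_vec :: "nat \<Rightarrow> step \<Rightarrow> int \<times> int" where
  "step_vec k U = (1, 1)"
| "step_vec k D = (1, 1 - int k)"

text \<open>The point reached from \<open>(0, \<alpha>)\<close> after the first \<open>j\<close> steps of \<open>p\<close>.\<close>

definition vertex :: "nat \<Rightarrow> int \<Rightarrow> step list \<Rightarrow> nat \<Rightarrow> int \<times> int" where
  "vertex k \<alpha> p j = (0, \<alpha>) + (\<Sum>s\<leftarrow>take j p. step_vec k s)"

definition kDyck_paths :: "nat \<Rightarrow> nat \<Rightarrow> int \<Rightarrow> int \<Rightarrow> step list set" where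
  "kDyck_paths k n \<alpha> \<beta> =
     {p. vertex k \<alpha> p (length p) = (int k * int n + \<beta> - \<alpha>, \<beta>) \<and>
         (\<forall>j\<le>length p. 0 \<le> snd (vertex k \<alpha> p j))}"

definition kDyck_number :: "nat \<Rightarrow> nat \<Rightarrow> int \<Rightarrow> int \<Rightarrow> nat" where
  "kDyck_number k n \<alpha> \<beta> = (if \<alpha> < 0 \<or> \<beta> < 0 then 0 else card (kDyck_paths k n \<alpha> \<beta>))"

definition returns :: "nat \<Rightarrow> int \<Rightarrow> step list \<Rightarrow> nat" where
  "returns k \<alpha> p = card {j. j < length p \<and> p ! j = D \<and> snd (vertex k \<alpha> p (Suc j)) = 0}"

definition kDyck_returns_number :: "nat \<Rightarrow> nat \<Rightarrow> int \<Rightarrow> int \<Rightarrow> nat \<Rightarrow> nat" where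
  "kDyck_returns_number k n \<alpha> \<beta> \<rho> = card {p \<in> kDyck_paths k n \<alpha> \<beta>. returns k \<alpha> p = \<rho>}"

definition kCatalan_fps :: "nat \<Rightarrow> rat fps" where
  "kCatalan_fps k = Abs_fps (\<lambda>n. 1 / of_nat (k * n + 1) * of_nat ((k * n + 1) choose n))"

definition raney :: "nat \<Rightarrow> nat \<Rightarrow> nat \<Rightarrow> rat" where
  "raney k r m = fps_nth (kCatalan_fps k ^ r) m"

lemma vertex_fst: "j \<le> length p \<Longrightarrow> fst (vertex k \<alpha> p j) = int j"
proof -
  have "fst (\<Sum>s\<leftarrow>xs. step_vec k s) = int (length xs)" for xs
  proof (induction xs)
    case (Cons s xs)
    then show ?case by (cases s) auto
  qed simp
  then show "j \<le> length p \<Longrightarrow> ?thesis" by (simp add: vertex_def)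
qed

text \<open>Hence the uses of \<^const>\<open>card\<close> above are not degenerate.\<close>

lemma finite_kDyck_paths: "finite (kDyck_paths k n \<alpha> \<beta>)"
proof (rule finite_subset)
  have "UNIV = {U, D}"
    using step.exhaust by auto
  then have "finite (UNIV :: step set)"
    by (metis finite.emptyI finite.insertI)
  then show "finite {p :: step list. set p \<subseteq> UNIV \<and> length p = nat (int k * int n + \<beta> - \<alpha>)}"
    by (rule finite_lists_length_eq)
  show "kDyck_paths k n \<alpha> \<beta> \<subseteq> {p. set p \<subseteq> UNIV \<and> length p = nat (int k * int n + \<beta> - \<alpha>)}"
  proof
    fix p assume "p \<in> kDyck_paths k n \<alpha> \<beta>"
    then have "fst (vertex k \<alpha> p (length p)) = int k * int n + \<beta> - \<alpha>"
      by (simp add: kDyck_paths_def)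
    then have "int (length p) = int k * int n + \<beta> - \<alpha>"
      by (simp add: vertex_fst)
    then show "p \<in> {p. set p \<subseteq> UNIV \<and> length p = nat (int k * int n + \<beta> - \<alpha>)}"
      by simp
  qed
qed

end

theory Submission
  imports Defs
begin

text \<open>Removing the last step of a path gives a recurrence for the number of paths with a given
  number of returns, in which \<open>k n + \<beta>\<close> drops by one. The right-hand side satisfies the same
  recurrence: for \<open>\<rho> = 0\<close> since it counts paths itself, and for \<open>\<rho> > 0\<close> because
  \<open>C\<^sub>k = 1 + t C\<^sub>k\<^sup>k\<close> yields \<open>C\<^sub>k\<^bsup>r+1\<^esup> = C\<^sub>k\<^bsup>r\<^esup> + t C\<^sub>k\<^bsup>r+k\<^esup>\<close>. At \<open>\<beta> = 0\<close> the last step is a return,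
  and for \<open>\<rho> > 1\<close> replacing \<open>(0, \<rho>)\<close> by \<open>(k - 1, \<rho> - 1)\<close> keeps the Raney exponent and shifts \<open>n\<close> by one.
  The functional equation holds since the Raney numbers, written as differences of binomial
  coefficients, satisfy a recurrence that their convolutions satisfy as well.\<close>

section \<open>Raney numbers\<close>

text \<open>For \<open>k m + r > 0\<close> this is \<open>r / (k m + r) * ((k m + r) choose m)\<close>; in this form the
  recurrence is Pascal's rule.\<close>

definition ballot :: "nat \<Rightarrow> nat \<Rightarrow> nat \<Rightarrow> rat" where
  "ballot k r m = of_nat ((k * m + r - 1) choose m) -
     (if m = 0 then 0 else (of_nat k - 1) * of_nat ((k * m + r - 1) choose (m - 1)))"

lemma ballot_0_right [simp]: "ballot k r 0 = 1"
  by (simp add: ballot_def)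

text \<open>Absorption gives \<open>(m + 1) * (K choose (m + 1)) = (K - m) * (K choose m)\<close>.
  For \<open>K = k * (m + 1) - 1\<close> the factor \<open>K - m\<close> is
  \<open>(k - 1) * (m + 1)\<close>, so the two terms cancel.\<close>

lemma ballot_0_Suc:
  assumes "k \<ge> 1"
  shows "ballot k 0 (Suc m) = 0"
proof -
  define K where "K = k * Suc m - 1"
  have K: "(of_nat K :: rat) = of_nat k * (of_nat m + 1) - 1"
    using assms by (simp add: K_def of_nat_diff algebra_simps)
  have "K \<ge> m"
    using mult_le_mono1[OF assms, of "Suc m"] by (simp add: K_def)
  have "Suc m * (K choose Suc m) = (K - m) * (K choose m)"
    by (metis binomial_absorb_comp binomial_absorption)
  then have "of_nat (Suc m * (K choose Suc m)) = (of_nat ((K - m) * (K choose m)) :: rat)"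
    by presburger
  then have "(of_nat m + 1) * of_nat (K choose Suc m) =
      (of_nat m + 1) * ((of_nat k - 1) * (of_nat (K choose m) :: rat))"
    using \<open>K \<ge> m\<close> by (simp add: of_nat_diff K algebra_simps)
  moreover have "(of_nat m + 1 :: rat) \<noteq> 0"
    by (metis of_nat_Suc of_nat_neq_0 add.commute)
  ultimately show ?thesis
    by (simp add: ballot_def K_def)
qed

lemma ballot_Suc_Suc:
  assumes "k \<ge> 1"
  shows "ballot k (Suc r) (Suc m) = ballot k r (Suc m) + ballot k (r + k) m"
proof -
  \<comment> \<open>Both terms on the right then have upper index \<open>M\<close>, the left one has
    \<open>Suc M\<close>, and Pascal's rule splits both of its binomials.\<close>
  obtain M where M: "k * Suc m + r = Suc M"
    using assms by (cases "k * Suc m + r") auto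
  have "k * m + (r + k) = Suc M"
    using M by simp
  then show ?thesis
    using M by (cases m) (simp_all add: ballot_def algebra_simps)
qed

lemma ballot_1:
  assumes "k \<ge> 1"
  shows "ballot k 1 m = 1 / of_nat (k * m + 1) * of_nat ((k * m + 1) choose m)"
proof (cases m)
  case (Suc l)
  define K where "K = k * m"
  have "Suc l \<le> K"
    using assms Suc mult_le_mono1[of 1 k m] by (simp add: K_def)
  have "Suc l * (K choose Suc l) = (K - l) * (K choose l)"
    by (metis binomial_absorb_comp binomial_absorption)
  then have "of_nat (Suc l * (K choose Suc l)) = (of_nat ((K - l) * (K choose l)) :: rat)"
    by presburger
  then have eq: "(of_nat l + 1) * of_nat (K choose Suc l) =
      (of_nat K - of_nat l) * (of_nat (K choose l) :: rat)"
    using \<open>Suc l \<le> K\<close> by (simp add: of_nat_diff algebra_simps)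
  have K: "of_nat K = of_nat k * (of_nat l + 1 :: rat)"
    by (simp add: K_def Suc algebra_simps)
  \<comment> \<open>The right-hand side is \<open>Suc K choose Suc l\<close> by Pascal's rule;
    dividing by \<open>Suc K\<close> gives the k-Catalan coefficient.\<close>
  have "of_nat (Suc K) * (of_nat (K choose Suc l) - (of_nat k - 1) * of_nat (K choose l)) =
      (of_nat (K choose l) + of_nat (K choose Suc l) :: rat)"
    using eq unfolding of_nat_Suc K by algebra
  moreover have "(of_nat (Suc K) :: rat) \<noteq> 0"
    by (metis of_nat_neq_0)
  ultimately have "of_nat (K choose Suc l) - (of_nat k - 1) * of_nat (K choose l) =
      (1 / of_nat (Suc K)) * (of_nat (K choose l) + of_nat (K choose Suc l) :: rat)"
    by (simp add: field_simps)
  then show ?thesis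
    unfolding ballot_def K_def[symmetric] by (simp add: Suc)
qed simp

section \<open>Generating series of the ballot numbers\<close>

lemma ballot_fps_Suc:
  assumes "k \<ge> 1"
  shows "Abs_fps (ballot k (Suc r)) = Abs_fps (ballot k r) + fps_X * Abs_fps (ballot k (r + k))"
proof (rule fps_ext)
  fix m
  show "fps_nth (Abs_fps (ballot k (Suc r))) m =
      fps_nth (Abs_fps (ballot k r) + fps_X * Abs_fps (ballot k (r + k))) m"
    using assms by (cases m) (simp_all add: ballot_Suc_Suc)
qed

lemma ballot_fps_0: "k \<ge> 1 \<Longrightarrow> Abs_fps (ballot k 0) = 1"
  by (rule fps_ext) (metis ballot_0_Suc ballot_0_right fps_nth_Abs_fps fps_one_nth not0_implies_Suc)

text \<open>As functions of \<open>a\<close>, both sides are solutions of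
  \<open>F (a + 1) = F a + X * F (a + k)\<close> and agree at \<open>a = 0\<close>. The larger
  argument \<open>a + k\<close> is harmless: the factor X lowers the coefficient index, so the outer
  induction runs on that index for all \<open>a\<close> at once.\<close>

lemma ballot_fps_mult:
  assumes "k \<ge> 1"
  shows "Abs_fps (ballot k a) * Abs_fps (ballot k b) = Abs_fps (ballot k (a + b))"
proof -
  have "fps_nth (Abs_fps (ballot k a) * Abs_fps (ballot k b)) m =
      fps_nth (Abs_fps (ballot k (a + b))) m" for m
  proof (induction m arbitrary: a)
    case (Suc m)
    then show ?case
    proof (induction a)
      case 0
      then show ?case
        using assms by (simp add: ballot_fps_0)
    next
      case (Suc a)
      have "Abs_fps (ballot k (Suc a)) * Abs_fps (ballot k b) =
          Abs_fps (ballot k a) * Abs_fps (ballot k b) +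
          fps_X * (Abs_fps (ballot k (a + k)) * Abs_fps (ballot k b))"
        using assms by (simp add: ballot_fps_Suc algebra_simps)
      moreover have "Abs_fps (ballot k (Suc a + b)) =
          Abs_fps (ballot k (a + b)) + fps_X * Abs_fps (ballot k (a + k + b))"
        using ballot_fps_Suc[OF assms, of "a + b"] by (simp add: add_ac)
      ultimately show ?case
        using Suc.IH[OF Suc.prems] Suc.prems[of "a + k"] by simp
    qed
  qed simp
  then show ?thesis
    by (simp add: fps_eq_iff)
qed

lemma kCatalan_fps_eq_ballot: "k \<ge> 1 \<Longrightarrow> kCatalan_fps k = Abs_fps (ballot k 1)"
  by (rule fps_ext) (simp only: kCatalan_fps_def ballot_1 fps_nth_Abs_fps)

lemma kCatalan_fps_power:
  assumes "k \<ge> 1"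
  shows "kCatalan_fps k ^ r = Abs_fps (ballot k r)"
  using assms by (induction r) (simp_all add: ballot_fps_0 kCatalan_fps_eq_ballot ballot_fps_mult)

lemma kCatalan_fps_power_Suc:
  assumes "k \<ge> 1"
  shows "kCatalan_fps k ^ Suc r = kCatalan_fps k ^ r + fps_X * kCatalan_fps k ^ (r + k)"
  using assms by (simp only: kCatalan_fps_power ballot_fps_Suc)

section \<open>Removing the last step\<close>

definition height :: "nat \<Rightarrow> int \<Rightarrow> step list \<Rightarrow> int" where
  "height k \<alpha> p = \<alpha> + (\<Sum>s\<leftarrow>p. snd (step_vec k s))"

lemma height_Nil [simp]: "height k \<alpha> [] = \<alpha>"
  and height_snoc_U [simp]: "height k \<alpha> (p @ [U]) = height k \<alpha> p + 1"
  and height_snoc_D [simp]: "height k \<alpha> (p @ [D]) = height k \<alpha> p + 1 - int k"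
  by (simp_all add: height_def)

lemma snd_vertex: "snd (vertex k \<alpha> p j) = height k \<alpha> (take j p)"
proof -
  have "snd (\<Sum>s\<leftarrow>xs. step_vec k s) = (\<Sum>s\<leftarrow>xs. snd (step_vec k s))" for xs
    by (induction xs) auto
  then show ?thesis
    by (simp add: vertex_def height_def)
qed

lemma height_eq: "height k \<alpha> p = \<alpha> + int (length p) - int k * int (count_list p D)"
proof (induction p rule: rev_induct)
  case (snoc s p)
  then show ?case
    by (cases s) (simp_all add: algebra_simps)
qed simp

text \<open>Once the final height is fixed, the length determines the number of D steps because k is
  positive. This turns \<open>n\<close> into a step counter that drops by one with each removed
  D.\<close>

lemma mem_kDyck_paths_iff:
  assumes "k \<ge> 1"
  shows "p \<in> kDyck_paths k n \<alpha> \<beta> \<longleftrightarrow>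
    count_list p D = n \<and> height k \<alpha> p = \<beta> \<and> (\<forall>j\<le>length p. 0 \<le> height k \<alpha> (take j p))"
proof -
  have "vertex k \<alpha> p (length p) = (int (length p), height k \<alpha> p)"
    by (simp add: prod_eq_iff vertex_fst snd_vertex)
  moreover have "int (length p) = int k * int n + \<beta> - \<alpha> \<longleftrightarrow> count_list p D = n"
    if "height k \<alpha> p = \<beta>"
    using that assms by (auto simp: height_eq)
  ultimately show ?thesis
    by (auto simp: kDyck_paths_def snd_vertex)
qed

lemma all_prefixes_snoc:
  "(\<forall>j\<le>length (p @ [s]). P (take j (p @ [s]))) \<longleftrightarrow> (\<forall>j\<le>length p. P (take j p)) \<and> P (p @ [s])"
  by (auto simp: le_Suc_eq)

lemma Nil_mem_kDyck_paths_iff: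
  "k \<ge> 1 \<Longrightarrow> [] \<in> kDyck_paths k n \<alpha> \<beta> \<longleftrightarrow> n = 0 \<and> \<alpha> = \<beta> \<and> 0 \<le> \<alpha>"
  by (auto simp: mem_kDyck_paths_iff)

text \<open>The new endpoint satisfies the ground condition since \<beta> is nonnegative. For
  \<beta> = 0 both sides fail, as \<open>p\<close> would end at height -1.\<close>

lemma snoc_U_mem_kDyck_paths_iff:
  assumes "k \<ge> 1" "\<beta> \<ge> 0"
  shows "p @ [U] \<in> kDyck_paths k n \<alpha> \<beta> \<longleftrightarrow> p \<in> kDyck_paths k n \<alpha> (\<beta> - 1)"
  unfolding mem_kDyck_paths_iff[OF assms(1)] all_prefixes_snoc[where P = "\<lambda>q. 0 \<le> height k \<alpha> q"]
  using assms by auto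

lemma snoc_D_mem_kDyck_paths_iff:
  assumes "k \<ge> 1" "\<beta> \<ge> 0"
  shows "p @ [D] \<in> kDyck_paths k n \<alpha> \<beta> \<longleftrightarrow>
    n > 0 \<and> p \<in> kDyck_paths k (n - 1) \<alpha> (\<beta> + int k - 1)"
  unfolding mem_kDyck_paths_iff[OF assms(1)] all_prefixes_snoc[where P = "\<lambda>q. 0 \<le> height k \<alpha> q"]
  using assms by auto

lemma kDyck_paths_negative: "\<beta> < 0 \<Longrightarrow> kDyck_paths k n \<alpha> \<beta> = {}"
  by (force simp: kDyck_paths_def)

lemma returns_Nil [simp]: "returns k \<alpha> [] = 0"
  by (simp add: returns_def)

lemma returns_snoc:
  "returns k \<alpha> (p @ [s]) = returns k \<alpha> p + of_bool (s = D \<and> height k \<alpha> (p @ [s]) = 0)"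
proof -
  have "{j. j < length (p @ [s]) \<and> (p @ [s]) ! j = D \<and> snd (vertex k \<alpha> (p @ [s]) (Suc j)) = 0} =
      {j. j < length p \<and> p ! j = D \<and> snd (vertex k \<alpha> p (Suc j)) = 0} \<union>
      (if s = D \<and> height k \<alpha> (p @ [s]) = 0 then {length p} else {})"
    by (auto simp: snd_vertex less_Suc_eq nth_append)
  then show ?thesis
    by (simp add: returns_def card_insert_if)
qed

text \<open>A path is empty, ends in U or ends in D, and appending a fixed step is injective. The
  predicate \<open>Q\<close> lets one count serve both for all paths and for a prescribed number of
  returns.\<close>

lemma card_kDyck_paths_snoc:
  assumes "k \<ge> 1" "\<alpha> \<ge> 0" "\<beta> \<ge> 0"
  shows "card {p \<in> kDyck_paths k n \<alpha> \<beta>. Q p} =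
    of_bool (n = 0 \<and> \<alpha> = \<beta> \<and> Q []) +
    card {p \<in> kDyck_paths k n \<alpha> (\<beta> - 1). Q (p @ [U])} +
    (if n = 0 then 0 else card {p \<in> kDyck_paths k (n - 1) \<alpha> (\<beta> + int k - 1). Q (p @ [D])})"
proof -
  define N where "N = (if n = 0 \<and> \<alpha> = \<beta> \<and> Q [] then {[] :: step list} else {})"
  define AU where "AU = {p \<in> kDyck_paths k n \<alpha> (\<beta> - 1). Q (p @ [U])}"
  \<comment> \<open>The guard is essential: truncated \<open>n - 1\<close> would admit paths at
    \<open>n = 0\<close>.\<close>
  define AD where "AD = (if n = 0 then {} else
    {p \<in> kDyck_paths k (n - 1) \<alpha> (\<beta> + int k - 1). Q (p @ [D])})"
  note iffs = Nil_mem_kDyck_paths_iff snoc_U_mem_kDyck_paths_iff snoc_D_mem_kDyck_paths_iff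
  have "p \<in> kDyck_paths k n \<alpha> \<beta> \<and> Q p \<longleftrightarrow>
      p \<in> N \<union> (\<lambda>p. p @ [U]) ` AU \<union> (\<lambda>p. p @ [D]) ` AD" for p
  proof (cases p rule: rev_cases)
    case Nil
    then show ?thesis
      using assms by (auto simp: N_def iffs)
  next
    case (snoc q s)
    then show ?thesis
      using assms by (cases s) (auto simp: N_def AU_def AD_def iffs)
  qed
  then have "{p \<in> kDyck_paths k n \<alpha> \<beta>. Q p} =
      N \<union> (\<lambda>p. p @ [U]) ` AU \<union> (\<lambda>p. p @ [D]) ` AD"
    by blast
  moreover have "finite N" "finite AU" "finite AD"
    by (simp_all add: N_def AU_def AD_def finite_kDyck_paths)
  moreover have "N \<inter> (\<lambda>p. p @ [U]) ` AU = {}"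
    "(N \<union> (\<lambda>p. p @ [U]) ` AU) \<inter> (\<lambda>p. p @ [D]) ` AD = {}"
    by (auto simp: N_def)
  ultimately have "card {p \<in> kDyck_paths k n \<alpha> \<beta>. Q p} = card N + card AU + card AD"
    by (simp add: card_Un_disjoint card_image inj_on_def)
  then show ?thesis
    by (simp add: N_def AU_def AD_def)
qed

lemma kDyck_number_rec:
  assumes "k \<ge> 1" "\<alpha> \<ge> 0" "\<beta> \<ge> 0"
  shows "kDyck_number k n \<alpha> \<beta> = of_bool (n = 0 \<and> \<alpha> = \<beta>) + kDyck_number k n \<alpha> (\<beta> - 1) +
    (if n = 0 then 0 else kDyck_number k (n - 1) \<alpha> (\<beta> + int k - 1))"
  using card_kDyck_paths_snoc[OF assms, of n "\<lambda>_. True"] assms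
  by (auto simp: kDyck_number_def kDyck_paths_negative)

text \<open>Since \<beta> is positive, the last step is no return and the shorter path keeps the
  same \<rho>.\<close>

lemma kDyck_returns_number_rec:
  assumes "k \<ge> 1" "\<alpha> \<ge> 0" "\<beta> > 0"
  shows "kDyck_returns_number k n \<alpha> \<beta> \<rho> =
    of_bool (n = 0 \<and> \<alpha> = \<beta> \<and> \<rho> = 0) + kDyck_returns_number k n \<alpha> (\<beta> - 1) \<rho> +
    (if n = 0 then 0 else kDyck_returns_number k (n - 1) \<alpha> (\<beta> + int k - 1) \<rho>)"
proof -
  have "{p \<in> kDyck_paths k (n - 1) \<alpha> (\<beta> + int k - 1). returns k \<alpha> (p @ [D]) = \<rho>} =
      {p \<in> kDyck_paths k (n - 1) \<alpha> (\<beta> + int k - 1). returns k \<alpha> p = \<rho>}"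
    using assms by (auto simp: returns_snoc mem_kDyck_paths_iff)
  then show ?thesis
    using card_kDyck_paths_snoc[of k \<alpha> \<beta> n "\<lambda>p. returns k \<alpha> p = \<rho>"] assms
    by (auto simp: kDyck_returns_number_def returns_snoc)
qed

text \<open>A path from positive height to the ground is nonempty and cannot end in U, which would
  start at height -1. Its last step is thus a D from height \<open>k - 1\<close>, and a
  return.\<close>

lemma kDyck_returns_number_rec_ground:
  assumes "k \<ge> 1" "\<alpha> > 0"
  shows "kDyck_returns_number k n \<alpha> 0 \<rho> =
    (if n = 0 \<or> \<rho> = 0 then 0 else kDyck_returns_number k (n - 1) \<alpha> (int k - 1) (\<rho> - 1))"
proof -
  have "{p \<in> kDyck_paths k (n - 1) \<alpha> (int k - 1). returns k \<alpha> (p @ [D]) = \<rho>} =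
      (if \<rho> = 0 then {} else {p \<in> kDyck_paths k (n - 1) \<alpha> (int k - 1). returns k \<alpha> p = \<rho> - 1})"
    using assms by (auto simp: returns_snoc mem_kDyck_paths_iff)
  moreover have "kDyck_returns_number k n \<alpha> 0 \<rho> = (if n = 0 then 0 else
      card {p \<in> kDyck_paths k (n - 1) \<alpha> (int k - 1). returns k \<alpha> (p @ [D]) = \<rho>})"
    using card_kDyck_paths_snoc[of k \<alpha> 0 n "\<lambda>p. returns k \<alpha> p = \<rho>"] assms
    by (simp add: kDyck_returns_number_def kDyck_paths_negative)
  ultimately show ?thesis
    by (simp only: kDyck_returns_number_def split: if_split) simp
qed

section \<open>Counting by returns to ground\<close>

text \<open>From positive height the ground is reached only by D steps, so no return means staying
  at height at least 1, and the path can be shifted down. The proof compares recurrences; at \<beta>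
  = 0 the right side vanishes by convention.\<close>

lemma kDyck_returns_number_0:
  fixes \<alpha> \<beta> :: nat
  assumes "k \<ge> 1" "\<alpha> > 0"
  shows "kDyck_returns_number k n (int \<alpha>) (int \<beta>) 0 = kDyck_number k n (int \<alpha> - 1) (int \<beta> - 1)"
\<comment> \<open>Removing U lowers \<beta> by one; removing D replaces \<open>(n, \<beta>)\<close>
  by \<open>(n - 1, \<beta> + k - 1)\<close>. Either way the measure drops by one.\<close>
proof (induction "k * n + \<beta>" arbitrary: n \<beta> rule: less_induct)
  case less
  show ?case
  proof (cases \<beta>)
    case 0
    then show ?thesis
      using assms kDyck_returns_number_rec_ground[of k "int \<alpha>" n 0]
      by (simp add: kDyck_number_def)
  next
    case (Suc b)
    have U: "kDyck_returns_number k n (int \<alpha>) (int b) 0 = kDyck_number k n (int \<alpha> - 1) (int b - 1)"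
      by (rule less) (simp add: Suc)
    have D: "kDyck_returns_number k (n - 1) (int \<alpha>) (int (b + k)) 0 =
        kDyck_number k (n - 1) (int \<alpha> - 1) (int (b + k) - 1)" if "n \<noteq> 0"
      by (rule less) (use that in \<open>cases n; simp add: Suc\<close>)
    show ?thesis
      using assms U D kDyck_returns_number_rec[of k "int \<alpha>" "int \<beta>" n 0]
        kDyck_number_rec[of k "int \<alpha> - 1" "int b" n]
      by (auto simp: Suc algebra_simps)
  qed
qed

text \<open>The convolution as one coefficient: \<open>fps_X ^ \<rho>\<close> marks the return
  steps, the middle series counts the part before the first return, and the power of
  \<open>kCatalan_fps k\<close> accounts for the rest.\<close>

lemma kDyck_returns_number_pos:
  fixes \<alpha> \<beta> :: nat
  assumes "k \<ge> 2" "\<alpha> > 0" "\<rho> > 0"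
  shows "of_nat (kDyck_returns_number k n (int \<alpha>) (int \<beta>) \<rho>) =
    fps_nth (fps_X ^ \<rho> * (Abs_fps (\<lambda>i. of_nat (kDyck_number k i (int \<alpha> - 1) (int k - 2))) *
      kCatalan_fps k ^ (\<beta> + (\<rho> - 1) * (k - 1)))) n"
proof -
  define A :: "rat fps" where
    "A = Abs_fps (\<lambda>i. of_nat (kDyck_number k i (int \<alpha> - 1) (int k - 2)))"
  define S where "S \<beta> \<rho> = fps_X ^ \<rho> * (A * kCatalan_fps k ^ (\<beta> + (\<rho> - 1) * (k - 1)))" for \<beta> \<rho>
  have k: "k \<ge> 1"
    using assms by simp
  have "of_nat (kDyck_returns_number k n (int \<alpha>) (int \<beta>) \<rho>) = fps_nth (S \<beta> \<rho>) n"
    using \<open>\<rho> > 0\<close>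
  proof (induction "k * n + \<beta>" arbitrary: n \<beta> \<rho> rule: less_induct)
    case less
    show ?case
    proof (cases \<beta>)
      case 0
      show ?thesis
      proof (cases n)
        case 0
        then show ?thesis
          using less.prems kDyck_returns_number_rec_ground[OF k, of "int \<alpha>" n \<rho>] \<open>\<beta> = 0\<close> assms
          by (simp add: S_def)
      next
        case (Suc m)
        have rec: "kDyck_returns_number k n (int \<alpha>) (int \<beta>) \<rho> =
            kDyck_returns_number k m (int \<alpha>) (int (k - 1)) (\<rho> - 1)"
          using less.prems kDyck_returns_number_rec_ground[OF k, of "int \<alpha>" n \<rho>] \<open>\<beta> = 0\<close> Suc assms
          by (simp add: of_nat_diff)
        show ?thesis
        \<comment> \<open>Without its only return the path ends at height \<open>k - 1\<close> and
          has no return, so the case \<rho> = 0 gives the coefficient of \<open>A\<close>; the Raney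
          exponent is 0 here.\<close>
        proof (cases "\<rho> = 1")
          case True
          then have "kDyck_returns_number k n (int \<alpha>) (int \<beta>) \<rho> =
              kDyck_number k m (int \<alpha> - 1) (int k - 2)"
            using rec kDyck_returns_number_0[OF k, of \<alpha> m "k - 1"] assms
            by (simp add: of_nat_diff)
          then show ?thesis
            using True \<open>\<beta> = 0\<close> Suc by (simp add: S_def A_def)
        next
          case False
          then obtain \<rho>' where \<rho>': "\<rho> = Suc (Suc \<rho>')"
            using less.prems by (cases \<rho>; cases "\<rho> - 1") auto
          \<comment> \<open>The exponents agree because
            \<open>(\<rho> - 1) * (k - 1) = (k - 1) + (\<rho> - 2) * (k - 1)\<close>.\<close>
          have "S 0 \<rho> = fps_X * S (k - 1) (\<rho> - 1)"
            by (simp add: S_def \<rho>' mult_ac)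
          then have "fps_nth (S 0 \<rho>) n = fps_nth (S (k - 1) (\<rho> - 1)) m"
            using Suc by simp
          moreover have "of_nat (kDyck_returns_number k m (int \<alpha>) (int (k - 1)) (\<rho> - 1)) =
              fps_nth (S (k - 1) (\<rho> - 1)) m"
            by (rule less) (use Suc \<open>\<beta> = 0\<close> \<rho>' k in simp_all)
          ultimately show ?thesis
            using rec \<open>\<beta> = 0\<close> by simp
        qed
      qed
    next
      case (Suc b)
      have U: "of_nat (kDyck_returns_number k n (int \<alpha>) (int b) \<rho>) = fps_nth (S b \<rho>) n"
        by (rule less) (use Suc less.prems in simp_all)
      have D: "of_nat (kDyck_returns_number k (n - 1) (int \<alpha>) (int (b + k)) \<rho>) =
          fps_nth (S (b + k) \<rho>) (n - 1)" if "n \<noteq> 0"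
        by (rule less) (use that less.prems in \<open>cases n; simp add: Suc\<close>)+
      \<comment> \<open>The two summands match the removal of U and of D; the factor X yields 0 at
        \<open>n = 0\<close>, as in the path recurrence.\<close>
      have "S (Suc b) \<rho> = S b \<rho> + fps_X * S (b + k) \<rho>"
        using kCatalan_fps_power_Suc[OF k, of "b + (\<rho> - 1) * (k - 1)"]
        by (simp add: S_def algebra_simps del: power_Suc)
      then have "fps_nth (S \<beta> \<rho>) n =
          fps_nth (S b \<rho>) n + (if n = 0 then 0 else fps_nth (S (b + k) \<rho>) (n - 1))"
        by (simp add: Suc)
      then show ?thesis
        using U D kDyck_returns_number_rec[of k "int \<alpha>" "int \<beta>" n \<rho>] k less.prems
        by (auto simp: Suc algebra_simps)
    qed
  qed
  then show ?thesis
    by (simp add: S_def A_def)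
qed

theorem theorem3p10:
  fixes k n \<alpha> \<beta> \<rho> :: nat
  assumes "k \<ge> 2" and "\<alpha> > 0"
  shows "(of_nat (kDyck_returns_number k n (int \<alpha>) (int \<beta>) \<rho>) :: rat) =
    (if \<rho> = 0 then of_nat (kDyck_number k n (int \<alpha> - 1) (int \<beta> - 1))
     else (\<Sum>i | i + \<rho> \<le> n.
             of_nat (kDyck_number k i (int \<alpha> - 1) (int k - 2)) *
             raney k (\<beta> + (\<rho> - 1) * (k - 1)) (n - \<rho> - i)))"
proof (cases "\<rho> = 0")
  case True
  then show ?thesis
    using assms by (simp add: kDyck_returns_number_0)
next
  case False
  \<comment> \<open>For \<open>n < \<rho>\<close> truncated \<open>n - \<rho>\<close> would leave
    the index 0; the empty range matches the zero coefficient instead.\<close>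
  have "{i. i + \<rho> \<le> n} = (if n < \<rho> then {} else {0..n - \<rho>})"
    by auto
  then show ?thesis
    using False assms
    by (simp add: kDyck_returns_number_pos fps_X_power_mult_nth raney_def) (simp add: fps_mult_nth)
qed

end
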